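(* Let $(M,d)$ be a finite metric space with $n$ elements, viewed as the weighted complete graph $K_n$ with vertex set $M$ in which the edge joining $u$ and $v$ has weight $d(u,v)$, and fix a reference orientation of the edges of $K_n$. Let $\ell_{1,d}=\ell_{1,d}(E(K_n))$ be the weighted $\ell_1$-space on the edge set of $K_n$ and let $Z\subset \ell_{1,d}$ be the cycle space of $K_n$. Then $\mathrm{TC}(M)=\ell_{1,d}/Z$, i.e. the transportation cost space $\mathrm{TC}(M)$ is isometrically isomorphic to the quotient normed space $\ell_{1,d}/Z$.
   Context: $\mathrm{TP}(M)$ denotes the real vector space of finitely supported functions $f:M\to\mathbb{R}$ with $\sum_{v\in\operatorname{supp} f} f(v)=0$. For $u\in M$, $\mathbf{1}_u$ is the indicator function of $\{u\}$. A transportation plan for $f\in\mathrm{TP}(M)$ is a representation $f=\sum_{i=1}^k a_i(\mathbf{1}_{x_i}-\mathbf{1}_{y_i})$ with $a_i\ge 0$, $x_i,y_i\in M$; its cost is $\sum_{i=1}^k a_i d(x_i,y_i)$. The norm $\|f\|_{\mathrm{TC}}$ is the minimal cost over all transportation plans for $f$. The transportation cost space $\mathrm{TC}(M)$ is the completion of $(\mathrm{TP}(M),\|\cdot\|_{\mathrm{TC}})$ (for finite $M$ it is $\mathrm{TP}(M)$ itself). $E(K_n)$ is the edge set of $K_n$. For $f:E(K_n)\to\mathbb{R}$, $f_{uv}$ denotes the value of $f$ on the edge $uv$. The space $\ell_{1,d}=\ell_{1,d}(E(K_n))$ is the space of all functions $f:E(K_n)\to\mathbb{R}$ with the norm $\|f\|_{1,d}=\sum_{uv\in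 E(K_n)}|f_{uv}|\,d(u,v)$. A reference orientation is a choice of one of the two orientations (a head and a tail) for each edge of $K_n$. For a cycle $C$ in $K_n$, pick one of the two orientations of $C$ for which each vertex of $C$ is the head of exactly one edge of $C$ and the tail of exactly one edge of $C$. The signed indicator function $\chi_C\in\ell_{1,d}$ of $C$ is defined by $\chi_C(e)=1$ if $e\in C$ and the orientation of $e$ in $C$ agrees with its reference orientation in $K_n$; $\chi_C(e)=-1$ if $e\in C$ and the two orientations are different; $\chi_C(e)=0$ if $e\notin C$. The cycle space $Z$ is the linear span in $\ell_{1,d}$ of the functions $\chi_C$ over all cycles $C$ in $K_n$. The quotient $\ell_{1,d}/Z$ carries the quotient norm. *)

theory Defs
  imports "HOL-Analysis.Analysis" "HOL-Library.Function_Algebras"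
begin

instantiation "fun" :: (type, real_vector) real_vector
begin

definition scaleR_fun :: "real \<Rightarrow> ('a \<Rightarrow> 'b) \<Rightarrow> 'a \<Rightarrow> 'b" where
  "scaleR_fun c f = (\<lambda>x. c *\<^sub>R f x)"

instance
  by standard (simp_all add: scaleR_fun_def plus_fun_def fun_eq_iff algebra_simps)

end

record 'v normed_struct =
  vectors :: "'v set"
  vadd :: "'v \<Rightarrow> 'v \<Rightarrow> 'v"
  vscale :: "real \<Rightarrow> 'v \<Rightarrow> 'v"
  vnorm :: "'v \<Rightarrow> real"

definition isometrically_isomorphic :: "'v normed_struct \<Rightarrow> 'w normed_struct \<Rightarrow> bool" where
  "isometrically_isomorphic V W \<longleftrightarrow>
    (\<exists>T. bij_betw T (vectors V) (vectors W) \<and>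
      (\<forall>x\<in>vectors V. \<forall>y\<in>vectors V. T (vadd V x y) = vadd W (T x) (T y)) \<and>
      (\<forall>c. \<forall>x\<in>vectors V. T (vscale V c x) = vscale W c (T x)) \<and>
      (\<forall>x\<in>vectors V. vnorm W (T x) = vnorm V x))"

(* The vectors are the cosets of Z. In the scaling operation the summand z only
   matters for c = 0, where the result has to be Z and not {0}. *)
definition quotient_struct ::
  "'v::real_vector set \<Rightarrow> ('v \<Rightarrow> real) \<Rightarrow> 'v set \<Rightarrow> 'v set normed_struct" where
  "quotient_struct V N Z =
    \<lparr> vectors = {(\<lambda>z. f + z) ` Z | f. f \<in> V},
      vadd = (\<lambda>X Y. {x + y | x y. x \<in> X \<and> y \<in> Y}),
      vscale = (\<lambda>c X. {c *\<^sub>R x + z | x z. x \<in> X \<and> z \<in> Z}),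
      vnorm = (\<lambda>X. Inf (N ` X)) \<rparr>"

text \<open>Functions on a set \<open>S\<close> are represented as functions on the whole type that
  vanish outside \<open>S\<close>.\<close>

definition TP :: "'a set \<Rightarrow> ('a \<Rightarrow> real) set" where
  "TP M = {f. {v. f v \<noteq> 0} \<subseteq> M \<and> finite {v. f v \<noteq> 0} \<and> (\<Sum>v | f v \<noteq> 0. f v) = 0}"

definition transportation_plan ::
  "'a set \<Rightarrow> ('a \<Rightarrow> real) \<Rightarrow> nat \<Rightarrow> (nat \<Rightarrow> real) \<Rightarrow> (nat \<Rightarrow> 'a) \<Rightarrow> (nat \<Rightarrow> 'a) \<Rightarrow> bool" where
  "transportation_plan M f k a x y \<longleftrightarrow>
    (\<forall>i<k. a i \<ge> 0 \<and> x i \<in> M \<and> y i \<in> M) \<and>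
    f = (\<Sum>i<k. a i *\<^sub>R (indicator {x i} - indicator {y i}))"

(* The infimum is attained, i.e. this is the minimal cost of a plan for f. *)
definition tc_norm :: "'a set \<Rightarrow> ('a \<Rightarrow> 'a \<Rightarrow> real) \<Rightarrow> ('a \<Rightarrow> real) \<Rightarrow> real" where
  "tc_norm M d f =
    Inf {(\<Sum>i<k. a i * d (x i) (y i)) | k a x y. transportation_plan M f k a x y}"

(* In general TC(M) is the completion of this space. For finite M, the only case
   in which TC is used, the space is finite-dimensional and hence is its own completion. *)
definition TC :: "'a set \<Rightarrow> ('a \<Rightarrow> 'a \<Rightarrow> real) \<Rightarrow> ('a \<Rightarrow> real) normed_struct" where
  "TC M d = \<lparr> vectors = TP M, vadd = (+), vscale = (*\<^sub>R), vnorm = tc_norm M d \<rparr>"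

definition complete_edges :: "'a set \<Rightarrow> 'a set set" where
  "complete_edges M = {{u, v} | u v. u \<in> M \<and> v \<in> M \<and> u \<noteq> v}"

(* Well defined on edges whenever d is symmetric. *)
definition edge_weight :: "('a \<Rightarrow> 'a \<Rightarrow> real) \<Rightarrow> 'a set \<Rightarrow> real" where
  "edge_weight d e = (THE r. \<exists>u v. e = {u, v} \<and> u \<noteq> v \<and> r = d u v)"

definition ell1 :: "'a set \<Rightarrow> ('a set \<Rightarrow> real) set" where
  "ell1 M = {f. \<forall>e. e \<notin> complete_edges M \<longrightarrow> f e = 0}"

definition ell1_norm :: "'a set \<Rightarrow> ('a \<Rightarrow> 'a \<Rightarrow> real) \<Rightarrow> ('a set \<Rightarrow> real) \<Rightarrow> real" where
  "ell1_norm M d f = (\<Sum>e\<in>complete_edges M. \<bar>f e\<bar> * edge_weight d e)"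

text \<open>Oriented edges are pairs (tail, head).\<close>

definition reference_orientation :: "'a set \<Rightarrow> ('a set \<Rightarrow> 'a \<times> 'a) \<Rightarrow> bool" where
  "reference_orientation M r \<longleftrightarrow> (\<forall>e\<in>complete_edges M. e = {fst (r e), snd (r e)})"

(* A cycle is identified with its edge set. *)
definition is_cycle :: "'a set \<Rightarrow> 'a set set \<Rightarrow> bool" where
  "is_cycle M C \<longleftrightarrow>
    (\<exists>c. distinct c \<and> length c \<ge> 3 \<and> set c \<subseteq> M \<and>
      C = {{c ! i, c ! (Suc i mod length c)} | i. i < length c})"

definition cycle_orientation :: "'a set set \<Rightarrow> ('a \<times> 'a) set \<Rightarrow> bool" where
  "cycle_orientation C A \<longleftrightarrow>
    (\<forall>a\<in>A. {fst a, snd a} \<in> C) \<and>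
    (\<forall>e\<in>C. \<exists>!a. a \<in> A \<and> e = {fst a, snd a}) \<and>
    (\<forall>v\<in>\<Union>C. \<exists>!a. a \<in> A \<and> snd a = v) \<and>
    (\<forall>v\<in>\<Union>C. \<exists>!a. a \<in> A \<and> fst a = v)"

definition signed_indicator ::
  "('a set \<Rightarrow> 'a \<times> 'a) \<Rightarrow> 'a set set \<Rightarrow> ('a \<times> 'a) set \<Rightarrow> 'a set \<Rightarrow> real" where
  "signed_indicator r C A e = (if e \<in> C then if r e \<in> A then 1 else -1 else 0)"

(* ori C is the orientation picked for the cycle C. Another pick changes
   the sign of some of the generators only. *)
definition cycle_space ::
  "'a set \<Rightarrow> ('a set \<Rightarrow> 'a \<times> 'a) \<Rightarrow> ('a set set \<Rightarrow> ('a \<times> 'a) set) \<Rightarrow> ('a set \<Rightarrow> real) set" where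
  "cycle_space M r ori = span {signed_indicator r C (ori C) | C. is_cycle M C}"

end

theory Submission
  imports Defs
begin

text \<open>
  A function \<open>f\<close> on the edges is a flow, carrying \<open>f e\<close> units along \<open>e\<close> in its reference direction.
  Moving one unit from \<open>x\<close> to \<open>y\<close> changes the mass distribution by
  \<open>\<one>\<^sub>x - \<one>\<^sub>y\<close>, and extending this linearly gives the divergence, a linear map from
  \<open>\<ell>\<^sub>1\<^sub>,\<^sub>d\<close> to \<open>TP(M)\<close>. By the first isomorphism theorem it is enough to see three things.

  The divergence is onto (\<open>divergence_image\<close>): every \<open>g\<close> in \<open>TP(M)\<close> is
  transported through a fixed base point \<open>p\<close>, by the flow that sends \<open>g v\<close> units from \<open>v\<close>
  to \<open>p\<close>; nothing accumulates at \<open>p\<close> because the total mass of \<open>g\<close> is zero.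

  Its kernel is the cycle space (\<open>cycle_space_eq_kernel\<close>). A flow around a cycle enters and
  leaves each vertex once. Conversely, rerouting every edge of a flow \<open>f\<close> through \<open>p\<close>
  changes \<open>f\<close> by a combination of triangles with apex \<open>p\<close>; if the divergence of \<open>f\<close>
  vanishes, so does the rerouted flow, and \<open>f\<close> itself is that combination.

  The transportation cost norm of \<open>g\<close> is the infimum of the weighted \<open>\<ell>\<^sub>1\<close> norm over the fibre of
  \<open>g\<close> (\<open>tc_norm_eq_Inf_ell1_norm\<close>): a flow, with the edges of negative value reversed, is a
  transportation plan of the same cost, and a plan, added up edge by edge, is a flow whose norm is at most the
  cost of the plan, cancellation on an edge being a gain. The fibres are the cosets of the cycle space,
  so this infimum is the quotient norm.
\<close>

section \<open>Quotients by the kernel of a linear map\<close>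

text \<open>
  The isometry sends \<open>g\<close> to its fibre under \<open>D\<close>, which is a coset of the kernel. On fibres, the
  assumption \<open>norm\<close> is exactly the statement that \<open>N'\<close> is the quotient norm.
\<close>

lemma isometrically_isomorphic_quotient_kernel:
  fixes D :: "'v::real_vector \<Rightarrow> 'w::real_vector"
  assumes lin: "linear D" and V: "subspace V" and surj: "D ` V = W"
    and ker: "Z = {f \<in> V. D f = 0}"
    and norm: "\<And>g. g \<in> W \<Longrightarrow> N' g = Inf (N ` {f \<in> V. D f = g})"
  shows "isometrically_isomorphic
    \<lparr> vectors = W, vadd = (+), vscale = (*\<^sub>R), vnorm = N' \<rparr> (quotient_struct V N Z)"
proof -
  define T where "T g = {f \<in> V. D f = g}" for g
  have coset: "T (D f) = (\<lambda>z. f + z) ` Z" if "f \<in> V" for f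
  proof
    show "T (D f) \<subseteq> (\<lambda>z. f + z) ` Z"
    proof
      fix x assume "x \<in> T (D f)"
      then have "x - f \<in> Z"
        using that V lin by (auto simp: T_def ker subspace_diff linear_diff)
      then show "x \<in> (\<lambda>z. f + z) ` Z" by (intro image_eqI[of _ _ "x - f"]) auto
    qed
    show "(\<lambda>z. f + z) ` Z \<subseteq> T (D f)"
      using that V lin by (auto simp: T_def ker subspace_add linear_add)
  qed
  have inj: "inj_on T W"
  proof (rule inj_onI)
    fix g h assume "g \<in> W" "T g = T h"
    then obtain f where "f \<in> T g" using surj by (auto simp: T_def)
    with \<open>T g = T h\<close> show "g = h" by (auto simp: T_def)
  qed
  have "T ` W = {(\<lambda>z. f + z) ` Z | f. f \<in> V}"
    unfolding surj[symmetric] image_image using coset by auto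
  with inj have bij: "bij_betw T W {(\<lambda>z. f + z) ` Z | f. f \<in> V}"
    by (simp add: bij_betw_def)
  have add: "T (g + h) = {x + y | x y. x \<in> T g \<and> y \<in> T h}" if g: "g \<in> W" for g h
  proof
    obtain f where f: "f \<in> V" "D f = g" using surj g by blast
    show "T (g + h) \<subseteq> {x + y | x y. x \<in> T g \<and> y \<in> T h}"
    proof
      fix x assume x: "x \<in> T (g + h)"
      then have "x - f \<in> T h"
        using f V lin by (auto simp: T_def subspace_diff linear_diff)
      moreover have "x = f + (x - f)" by simp
      moreover have "f \<in> T g" using f by (simp add: T_def)
      ultimately show "x \<in> {x + y | x y. x \<in> T g \<and> y \<in> T h}" by blast
    qed
    show "{x + y | x y. x \<in> T g \<and> y \<in> T h} \<subseteq> T (g + h)"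
      using V lin by (auto simp: T_def subspace_add linear_add)
  qed
  have scale: "T (c *\<^sub>R g) = {c *\<^sub>R x + z | x z. x \<in> T g \<and> z \<in> Z}" if g: "g \<in> W" for c g
  proof
    obtain f where f: "f \<in> V" "D f = g" using surj g by blast
    show "T (c *\<^sub>R g) \<subseteq> {c *\<^sub>R x + z | x z. x \<in> T g \<and> z \<in> Z}"
    proof
      fix x assume x: "x \<in> T (c *\<^sub>R g)"
      then have "x - c *\<^sub>R f \<in> Z"
        using f V lin by (auto simp: T_def ker subspace_diff subspace_scale linear_diff linear_scale)
      moreover have "x = c *\<^sub>R f + (x - c *\<^sub>R f)" by simp
      moreover have "f \<in> T g" using f by (simp add: T_def)
      ultimately show "x \<in> {c *\<^sub>R x + z | x z. x \<in> T g \<and> z \<in> Z}" by blast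
    qed
    show "{c *\<^sub>R x + z | x z. x \<in> T g \<and> z \<in> Z} \<subseteq> T (c *\<^sub>R g)"
      using V lin
      by (auto simp: T_def ker subspace_add subspace_scale linear_add linear_scale)
  qed
  show ?thesis
    unfolding isometrically_isomorphic_def quotient_struct_def
    using bij add scale norm by (intro exI[of _ T]) (auto simp: T_def)
qed

section \<open>Flows on the complete graph\<close>

text \<open>
  The flow of one unit from \<open>x\<close> to \<open>y\<close>, written in the coordinates given by the reference
  orientation. It is zero for \<open>x = y\<close>, which makes degenerate triangles and trivial moves in a
  transportation plan harmless.
\<close>

definition unit_flow :: "('a set \<Rightarrow> 'a \<times> 'a) \<Rightarrow> 'a \<Rightarrow> 'a \<Rightarrow> 'a set \<Rightarrow> real" where
  "unit_flow r x y e = (if x \<noteq> y \<and> e = {x, y} then if r e = (x, y) then 1 else -1 else 0)"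

text \<open>
  Outflow minus inflow at each vertex, i.e. the signed incidence matrix of the oriented graph applied to
  \<open>f\<close>; this sign makes a unit of flow from \<open>x\<close> to \<open>y\<close> transport
  \<open>\<one>\<^sub>x - \<one>\<^sub>y\<close>.
\<close>

definition divergence ::
  "'a set \<Rightarrow> ('a set \<Rightarrow> 'a \<times> 'a) \<Rightarrow> ('a set \<Rightarrow> real) \<Rightarrow> 'a \<Rightarrow> real" where
  "divergence M r f =
    (\<Sum>e\<in>complete_edges M. f e *\<^sub>R (indicator {fst (r e)} - indicator {snd (r e)}))"

lemma sum_fun_apply: "(\<Sum>i\<in>I. F i) x = (\<Sum>i\<in>I. F i x)"
  for F :: "'i \<Rightarrow> 'b \<Rightarrow> real"
  by (induction I rule: infinite_finite_induct) auto

lemma finite_complete_edges: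
  assumes "finite M" shows "finite (complete_edges M)"
proof -
  have "complete_edges M \<subseteq> Pow M" by (auto simp: complete_edges_def)
  then show ?thesis using assms finite_subset by blast
qed

lemma complete_edges_pair: "{x, y} \<in> complete_edges M \<longleftrightarrow> x \<in> M \<and> y \<in> M \<and> x \<noteq> y"
  by (auto simp: complete_edges_def doubleton_eq_iff)

lemma reference_orientation_edge:
  assumes "reference_orientation M r" "e \<in> complete_edges M"
  shows "fst (r e) \<in> M" "snd (r e) \<in> M" "fst (r e) \<noteq> snd (r e)" "{fst (r e), snd (r e)} = e"
proof -
  show e: "{fst (r e), snd (r e)} = e"
    using assms by (auto simp: reference_orientation_def)
  show "fst (r e) \<in> M" "snd (r e) \<in> M" "fst (r e) \<noteq> snd (r e)"
    using assms(2) complete_edges_pair[of "fst (r e)" "snd (r e)" M] unfolding e by auto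
qed

lemma reference_orientation_cases:
  assumes "reference_orientation M r" "x \<in> M" "y \<in> M" "x \<noteq> y"
  obtains "r {x, y} = (x, y)" | "r {x, y} = (y, x)"
  using reference_orientation_edge(4)[OF assms(1), of "{x, y}"] assms
  by (metis complete_edges_pair doubleton_eq_iff prod.collapse)

lemma subspace_ell1: "subspace (ell1 M)"
  by (auto simp: subspace_def ell1_def scaleR_fun_def)

lemma linear_divergence: "linear (divergence M r)"
  by (rule linearI)
    (simp_all add: divergence_def scaleR_fun_def sum_fun_apply fun_eq_iff
      algebra_simps sum.distrib sum_subtractf sum_distrib_left)

lemma unit_flow_same [simp]: "unit_flow r x x = 0"
  by (auto simp: unit_flow_def)

lemma unit_flow_swap:
  assumes "reference_orientation M r" "x \<in> M" "y \<in> M"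
  shows "unit_flow r y x = - unit_flow r x y"
proof (cases "x = y")
  case False
  show ?thesis
    using reference_orientation_cases[OF assms False]
    by cases (use False in \<open>auto simp: unit_flow_def fun_eq_iff insert_commute\<close>)
qed simp

lemma unit_flow_in_ell1:
  assumes "x \<in> M" "y \<in> M" shows "unit_flow r x y \<in> ell1 M"
  using assms by (auto simp: ell1_def unit_flow_def complete_edges_pair)

lemma divergence_unit_flow:
  assumes "finite M" "reference_orientation M r" "x \<in> M" "y \<in> M"
  shows "divergence M r (unit_flow r x y) = indicator {x} - indicator {y}"
proof (cases "x = y")
  case True
  then show ?thesis by (simp add: linear_0[OF linear_divergence])
next
  case False
  let ?F = "\<lambda>e. unit_flow r x y e *\<^sub>R (indicator {fst (r e)} - indicator {snd (r e)}) :: 'a \<Rightarrow> real"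
  have "divergence M r (unit_flow r x y) = (\<Sum>e\<in>{{x, y}}. ?F e)"
    unfolding divergence_def using assms False finite_complete_edges[of M]
    by (intro sum.mono_neutral_right)
      (auto simp: complete_edges_pair unit_flow_def scaleR_fun_def fun_eq_iff)
  also have "\<dots> = indicator {x} - indicator {y}"
    using reference_orientation_cases[OF assms(2-4) False]
    by cases (use False in \<open>auto simp: unit_flow_def scaleR_fun_def fun_eq_iff\<close>)
  finally show ?thesis .
qed

lemma ell1_expansion:
  assumes "finite M" "reference_orientation M r" "f \<in> ell1 M"
  shows "f = (\<Sum>e\<in>complete_edges M. f e *\<^sub>R unit_flow r (fst (r e)) (snd (r e)))"
proof
  fix e'
  have "(\<Sum>e\<in>complete_edges M. f e *\<^sub>R unit_flow r (fst (r e)) (snd (r e))) e'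
      = (\<Sum>e\<in>complete_edges M. if e = e' then f e else 0)"
    using reference_orientation_edge[OF assms(2)]
    by (auto simp: sum_fun_apply scaleR_fun_def unit_flow_def intro!: sum.cong)
  also have "\<dots> = f e'"
    using assms finite_complete_edges[of M] by (auto simp: ell1_def)
  finally show "f e' = (\<Sum>e\<in>complete_edges M. f e *\<^sub>R unit_flow r (fst (r e)) (snd (r e))) e'" ..
qed

lemma divergence_in_TP:
  assumes "finite M" "reference_orientation M r"
  shows "divergence M r f \<in> TP M"
proof -
  let ?g = "divergence M r f"
  have supp: "{v. ?g v \<noteq> 0} \<subseteq> M"
  proof
    fix v assume "v \<in> {v. ?g v \<noteq> 0}"
    then have "?g v \<noteq> 0" by simp
    then obtain e where "e \<in> complete_edges M"
      "(f e *\<^sub>R (indicator {fst (r e)} - indicator {snd (r e)}) :: 'a \<Rightarrow> real) v \<noteq> 0"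
      unfolding divergence_def sum_fun_apply by (meson sum.neutral)
    then have "v = fst (r e) \<or> v = snd (r e)"
      by (auto simp: scaleR_fun_def indicator_def of_bool_def split: if_splits)
    then show "v \<in> M"
      using reference_orientation_edge[OF assms(2) \<open>e \<in> complete_edges M\<close>] by auto
  qed
  have "(\<Sum>v | ?g v \<noteq> 0. ?g v) = (\<Sum>v\<in>M. ?g v)"
    using supp assms(1) by (intro sum.mono_neutral_left) auto
  also have "\<dots> = (\<Sum>e\<in>complete_edges M. f e *
      ((\<Sum>v\<in>M. indicator {fst (r e)} v) - (\<Sum>v\<in>M. indicator {snd (r e)} v)))"
    unfolding divergence_def sum_fun_apply
    by (subst sum.swap) (simp add: scaleR_fun_def sum_distrib_left sum_subtractf right_diff_distrib)
  also have "\<dots> = 0"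
    using assms reference_orientation_edge[OF assms(2)]
    by (intro sum.neutral) (auto simp: indicator_def)
  finally show ?thesis
    using supp assms(1) by (auto simp: TP_def intro: finite_subset)
qed

section \<open>Surjectivity and kernel of the divergence\<close>

text \<open>
  A linear right inverse of the divergence on \<open>TP(M)\<close>: everything is routed along the spanning star with
  centre \<open>p\<close>.
\<close>

definition star_flow :: "'a set \<Rightarrow> ('a set \<Rightarrow> 'a \<times> 'a) \<Rightarrow> 'a \<Rightarrow> ('a \<Rightarrow> real) \<Rightarrow> 'a set \<Rightarrow> real" where
  "star_flow M r p g = (\<Sum>v\<in>M. g v *\<^sub>R unit_flow r v p)"

lemma linear_star_flow: "linear (star_flow M r p)"
  by (rule linearI)
    (simp_all add: star_flow_def scaleR_fun_def sum_fun_apply fun_eq_iff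
      algebra_simps sum.distrib sum_subtractf sum_distrib_left)

lemma star_flow_indicator:
  assumes "finite M" "x \<in> M"
  shows "star_flow M r p (indicator {x}) = unit_flow r x p"
proof -
  have "star_flow M r p (indicator {x}) = (\<Sum>v\<in>{x}. indicator {x} v *\<^sub>R unit_flow r v p)"
    unfolding star_flow_def using assms
    by (intro sum.mono_neutral_right) (auto simp: scaleR_fun_def fun_eq_iff)
  then show ?thesis by (simp add: scaleR_fun_def fun_eq_iff)
qed

lemma star_flow_in_ell1:
  assumes "p \<in> M" shows "star_flow M r p g \<in> ell1 M"
  unfolding star_flow_def using assms
  by (intro subspace_sum subspace_scale subspace_ell1 unit_flow_in_ell1)

lemma divergence_star_flow:
  assumes "finite M" "reference_orientation M r" "p \<in> M" "g \<in> TP M"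
  shows "divergence M r (star_flow M r p g) = g"
proof -
  have supp: "{v. g v \<noteq> 0} \<subseteq> M" and sum0: "(\<Sum>v | g v \<noteq> 0. g v) = 0"
    using assms(4) by (auto simp: TP_def)
  have "(\<Sum>v\<in>M. g v) = (\<Sum>v | g v \<noteq> 0. g v)"
    by (rule sum.mono_neutral_right) (use assms(1) supp in auto)
  then have sum: "(\<Sum>v\<in>M. g v) = 0" using sum0 by simp
  have "divergence M r (star_flow M r p g)
      = (\<Sum>v\<in>M. g v *\<^sub>R (indicator {v} - indicator {p}))"
    unfolding star_flow_def linear_sum[OF linear_divergence]
    by (intro sum.cong) (use assms in \<open>simp_all add: linear_scale[OF linear_divergence] divergence_unit_flow\<close>)
  also have "\<dots> = g"
  proof
    fix w
    have "(\<Sum>v\<in>M. g v *\<^sub>R (indicator {v} - indicator {p})) w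
       = (\<Sum>v\<in>M. if v = w then g v else 0) - (\<Sum>v\<in>M. g v) * indicator {p} w"
      unfolding sum_fun_apply sum_distrib_right sum_subtractf[symmetric]
      by (intro sum.cong) (auto simp: scaleR_fun_def indicator_def)
    also have "\<dots> = g w" using assms(1) supp sum by auto
    finally show "(\<Sum>v\<in>M. g v *\<^sub>R (indicator {v} - indicator {p})) w = g w" .
  qed
  finally show ?thesis .
qed

lemma divergence_image:
  assumes "finite M" "reference_orientation M r"
  shows "divergence M r ` ell1 M = TP M"
proof
  show "divergence M r ` ell1 M \<subseteq> TP M" using divergence_in_TP[OF assms] by auto
  show "TP M \<subseteq> divergence M r ` ell1 M"
  proof
    fix g assume g: "g \<in> TP M"
    show "g \<in> divergence M r ` ell1 M"
    proof (cases "M = {}")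
      case True
      then have "g = 0" using g by (auto simp: TP_def fun_eq_iff)
      then show ?thesis
        using linear_0[OF linear_divergence] subspace_0[OF subspace_ell1] by (metis image_eqI)
    next
      case False
      then obtain p where "p \<in> M" by auto
      then show ?thesis
        using divergence_star_flow[OF assms _ g] star_flow_in_ell1 by (metis image_eqI)
    qed
  qed
qed

lemma is_cycle_subset:
  assumes "is_cycle M C" shows "C \<subseteq> complete_edges M"
proof
  fix e assume "e \<in> C"
  from assms obtain c where c: "distinct c" "length c \<ge> 3" "set c \<subseteq> M"
    "C = {{c ! i, c ! (Suc i mod length c)} | i. i < length c}"
    unfolding is_cycle_def by blast
  with \<open>e \<in> C\<close> obtain i where i: "i < length c" "e = {c ! i, c ! (Suc i mod length c)}" by blast
  let ?j = "Suc i mod length c"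
  have "?j < length c" using c(2) by (intro mod_less_divisor) auto
  moreover have "?j \<noteq> i"
    using i(1) c(2) by (cases "Suc i = length c") auto
  ultimately have "c ! i \<noteq> c ! ?j" "c ! i \<in> M" "c ! ?j \<in> M"
    using c i nth_eq_iff_index_eq by (metis, auto)
  then show "e \<in> complete_edges M" by (simp add: i complete_edges_pair)
qed

lemma cycle_orientationD:
  assumes "cycle_orientation C A"
  shows cycle_orientation_edge: "a \<in> A \<Longrightarrow> {fst a, snd a} \<in> C"
    and cycle_orientation_ex1: "e \<in> C \<Longrightarrow> \<exists>!a. a \<in> A \<and> e = {fst a, snd a}"
    and cycle_orientation_head: "v \<in> \<Union>C \<Longrightarrow> \<exists>!a. a \<in> A \<and> snd a = v"
    and cycle_orientation_tail: "v \<in> \<Union>C \<Longrightarrow> \<exists>!a. a \<in> A \<and> fst a = v"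
proof -
  note D = assms[unfolded cycle_orientation_def]
  show "{fst a, snd a} \<in> C" if "a \<in> A"
    using D[THEN conjunct1] that by (rule bspec)
  show "\<exists>!a. a \<in> A \<and> e = {fst a, snd a}" if "e \<in> C"
    using D[THEN conjunct2, THEN conjunct1] that by (rule bspec)
  show "\<exists>!a. a \<in> A \<and> snd a = v" if "v \<in> \<Union>C"
    using D[THEN conjunct2, THEN conjunct2, THEN conjunct1] that by (rule bspec)
  show "\<exists>!a. a \<in> A \<and> fst a = v" if "v \<in> \<Union>C"
    using D[THEN conjunct2, THEN conjunct2, THEN conjunct2] that by (rule bspec)
qed

text \<open>
  An orientation of a cycle uses each edge, each tail and each head only once. This is what forces the
  orientation of a triangle once one of its edges is oriented.
\<close>

lemma cycle_orientation_inj: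
  assumes "cycle_orientation C A" "a \<in> A" "b \<in> A"
    and "{fst a, snd a} = {fst b, snd b} \<or> fst a = fst b \<or> snd a = snd b"
  shows "a = b"
proof -
  have e: "{fst a, snd a} \<in> C" using cycle_orientation_edge[OF assms(1,2)] .
  then have v: "fst a \<in> \<Union>C" "snd a \<in> \<Union>C" by blast+
  show ?thesis
    using assms(2-4) cycle_orientation_ex1[OF assms(1) e]
      cycle_orientation_tail[OF assms(1) v(1)] cycle_orientation_head[OF assms(1) v(2)]
    by metis
qed

text \<open>
  Expresses a signed indicator through unit flows and so independently of the reference orientation: the signs
  of \<open>unit_flow\<close> are those of \<open>signed_indicator\<close>.
\<close>

lemma signed_indicator_eq_sum:
  assumes r: "reference_orientation M r" and C: "C \<subseteq> complete_edges M"
    and A: "cycle_orientation C A" and fin: "finite A"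
  shows "signed_indicator r C A = (\<Sum>a\<in>A. unit_flow r (fst a) (snd a))"
proof
  fix e
  show "signed_indicator r C A e = (\<Sum>a\<in>A. unit_flow r (fst a) (snd a)) e"
  proof (cases "e \<in> C")
    case False
    then have "unit_flow r (fst a) (snd a) e = 0" if "a \<in> A" for a
      using that A by (auto simp: cycle_orientation_def unit_flow_def)
    with False show ?thesis by (simp add: signed_indicator_def sum_fun_apply)
  next
    case True
    then have "\<exists>!a. a \<in> A \<and> e = {fst a, snd a}"
      using A by (auto simp: cycle_orientation_def)
    then obtain a where a: "a \<in> A" "e = {fst a, snd a}"
      and uniq: "\<And>b. b \<in> A \<Longrightarrow> e = {fst b, snd b} \<Longrightarrow> b = a" by metis
    have e: "e \<in> complete_edges M" using True C by auto
    then have ne: "fst a \<noteq> snd a" using a complete_edges_pair by metis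
    have off: "unit_flow r (fst b) (snd b) e = 0" if "b \<in> A - {a}" for b
      using uniq[of b] that unfolding unit_flow_def by (metis DiffE insertI1)
    have "(\<Sum>b\<in>A. unit_flow r (fst b) (snd b)) e = (\<Sum>b\<in>{a}. unit_flow r (fst b) (snd b) e)"
      unfolding sum_fun_apply
      by (rule sum.mono_neutral_right) (use a(1) fin off in auto)
    also have "\<dots> = (if r e = a then 1 else -1)"
      using a ne by (simp add: unit_flow_def)
    also have "r e = a \<longleftrightarrow> r e \<in> A"
      using a(1) uniq reference_orientation_edge(4)[OF r e] by metis
    also have "(if r e \<in> A then 1 else -1) = signed_indicator r C A e"
      using True by (simp add: signed_indicator_def)
    finally show ?thesis ..
  qed
qed

lemma cycle_orientation_subset:
  assumes "C \<subseteq> complete_edges M" "cycle_orientation C A"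
  shows "A \<subseteq> M \<times> M"
proof
  fix a assume "a \<in> A"
  then have "{fst a, snd a} \<in> complete_edges M"
    using assms by (auto simp: cycle_orientation_def)
  then show "a \<in> M \<times> M" by (simp add: complete_edges_pair mem_Times_iff)
qed

text \<open>
  Every vertex of the cycle is the tail of exactly one arc and the head of exactly one arc, so the sum of
  \<open>\<one>\<close> over the tails and the sum over the heads are the same sum over the vertices.
\<close>

lemma divergence_signed_indicator:
  assumes "finite M" "reference_orientation M r" and C: "C \<subseteq> complete_edges M"
    and A: "cycle_orientation C A"
  shows "divergence M r (signed_indicator r C A) = 0"
proof -
  have AM: "A \<subseteq> M \<times> M" using cycle_orientation_subset[OF C A] .
  then have fin: "finite A" using assms(1) finite_subset by blast
  have in_C: "{fst a, snd a} \<in> C" if "a \<in> A" for a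
    using cycle_orientation_edge[OF A that] .
  have fst_mem: "fst a \<in> \<Union>C" and snd_mem: "snd a \<in> \<Union>C" if "a \<in> A" for a
    using in_C[OF that] by blast+
  have "bij_betw p A (\<Union>C)"
    if "\<And>a. a \<in> A \<Longrightarrow> p a \<in> \<Union>C" "\<And>v. v \<in> \<Union>C \<Longrightarrow> \<exists>!a. a \<in> A \<and> p a = v"
    for p :: "'a \<times> 'a \<Rightarrow> 'a"
    by (rule bij_betwI') (use that in metis)+
  then have "bij_betw fst A (\<Union>C)" "bij_betw snd A (\<Union>C)"
    using fst_mem snd_mem cycle_orientation_tail[OF A] cycle_orientation_head[OF A] by simp_all
  then have eq: "(\<Sum>a\<in>A. indicator {fst a} :: 'a \<Rightarrow> real) = (\<Sum>a\<in>A. indicator {snd a})"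
    using sum.reindex_bij_betw[of fst A "\<Union>C" "\<lambda>v. indicator {v} :: 'a \<Rightarrow> real"]
      sum.reindex_bij_betw[of snd A "\<Union>C" "\<lambda>v. indicator {v} :: 'a \<Rightarrow> real"] by simp
  have "divergence M r (signed_indicator r C A)
      = (\<Sum>a\<in>A. indicator {fst a} - indicator {snd a})"
    unfolding signed_indicator_eq_sum[OF assms(2) C A fin] linear_sum[OF linear_divergence]
    by (intro sum.cong) (use assms AM in \<open>auto simp: divergence_unit_flow\<close>)
  then show ?thesis by (simp add: sum_subtractf eq)
qed

lemma is_cycle_triangle:
  assumes "x \<in> M" "y \<in> M" "z \<in> M" "x \<noteq> y" "y \<noteq> z" "z \<noteq> x"
  shows "is_cycle M {{x, y}, {y, z}, {z, x}}"
proof -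
  have "{i. i < length [x, y, z]} = {0, 1, 2}" by auto
  then have "{{x, y}, {y, z}, {z, x}}
      = {{[x, y, z] ! i, [x, y, z] ! (Suc i mod length [x, y, z])} | i. i < length [x, y, z]}"
    unfolding setcompr_eq_image by simp
  then show ?thesis
    unfolding is_cycle_def using assms by (intro exI[of _ "[x, y, z]"]) auto
qed

lemma cycle_orientation_triangle:
  assumes A: "cycle_orientation {{x, y}, {y, z}, {z, x}} A"
    and xy: "(x, y) \<in> A" and ne: "x \<noteq> y" "y \<noteq> z" "z \<noteq> x"
  shows "A = {(x, y), (y, z), (z, x)}"
proof -
  let ?C = "{{x, y}, {y, z}, {z, x}}"
  have edge: "(u, v) \<in> A \<or> (v, u) \<in> A" if uv: "{u, v} \<in> ?C" for u v
  proof -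
    obtain a where "a \<in> A" "{u, v} = {fst a, snd a}"
      using cycle_orientation_ex1[OF A uv] by blast
    then show ?thesis by (cases a) (auto simp: doubleton_eq_iff)
  qed
  note inj = cycle_orientation_inj[OF A]
  have "(y, z) \<in> A \<or> (z, y) \<in> A" by (rule edge) simp
  moreover have "(z, y) \<notin> A" using inj[OF xy, of "(z, y)"] ne by auto
  ultimately have yz: "(y, z) \<in> A" by auto
  have "(z, x) \<in> A \<or> (x, z) \<in> A" by (rule edge) simp
  moreover have "(x, z) \<notin> A" using inj[OF xy, of "(x, z)"] ne by auto
  ultimately have zx: "(z, x) \<in> A" by auto
  have "a \<in> {(x, y), (y, z), (z, x)}" if "a \<in> A" for a
    using cycle_orientation_edge[OF A that] inj[OF that xy] inj[OF that yz] inj[OF that zx]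
    by auto
  then show ?thesis using xy yz zx by auto
qed

text \<open>
  The orientation picked for the triangle may run either way round, so up to sign the boundary of the triangle
  is a generator. In the degenerate cases the flow cancels, by antisymmetry of \<open>unit_flow\<close>.
\<close>

lemma triangle_in_cycle_space:
  assumes r: "reference_orientation M r"
    and ori: "\<And>C. is_cycle M C \<Longrightarrow> cycle_orientation C (ori C)"
    and xyz: "x \<in> M" "y \<in> M" "z \<in> M"
  shows "unit_flow r x y + unit_flow r y z + unit_flow r z x \<in> cycle_space M r ori"
    (is "?t \<in> _")
proof (cases "x = y \<or> y = z \<or> z = x")
  case True
  then have "?t = 0"
  proof (elim disjE)
    assume "x = y" then show ?thesis using unit_flow_swap[OF r xyz(2,3)] by simp
  next
    assume "y = z" then show ?thesis using unit_flow_swap[OF r xyz(1,2)] by simp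
  next
    assume "z = x" then show ?thesis using unit_flow_swap[OF r xyz(1,2)] by simp
  qed
  then show ?thesis by (simp add: cycle_space_def span_0)
next
  case False
  then have ne: "x \<noteq> y" "y \<noteq> x" "y \<noteq> z" "z \<noteq> y" "z \<noteq> x" "x \<noteq> z" by auto
  define C where "C = {{x, y}, {y, z}, {z, x}}"
  \<comment> \<open>the same triangle listed in the opposite direction\<close>
  have C': "C = {{y, x}, {x, z}, {z, y}}" unfolding C_def by (auto simp: insert_commute)
  have cyc: "is_cycle M C" unfolding C_def using is_cycle_triangle xyz False by metis
  have C: "C \<subseteq> complete_edges M" using is_cycle_subset[OF cyc] .
  have A: "cycle_orientation C (ori C)" using ori[OF cyc] .
  have gen: "signed_indicator r C (ori C) \<in> cycle_space M r ori"
    unfolding cycle_space_def using cyc by (intro span_base) blast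
  have "{x, y} \<in> C" by (simp add: C_def)
  then obtain a where "a \<in> ori C" "{x, y} = {fst a, snd a}"
    using cycle_orientation_ex1[OF A] by blast
  then consider "(x, y) \<in> ori C" | "(y, x) \<in> ori C"
    by (cases a) (auto simp: doubleton_eq_iff)
  then show ?thesis
  proof cases
    case 1
    have "ori C = {(x, y), (y, z), (z, x)}"
      using cycle_orientation_triangle[OF A[unfolded C_def]] 1 False by (metis C_def)
    then have "signed_indicator r C (ori C) = ?t"
      using signed_indicator_eq_sum[OF r C A] ne by (simp add: add.assoc)
    with gen show ?thesis by simp
  next
    case 2
    have "cycle_orientation {{y, x}, {x, z}, {z, y}} (ori C)"
      unfolding C'[symmetric] by (rule A)
    then have "ori C = {(y, x), (x, z), (z, y)}"
      by (rule cycle_orientation_triangle[OF _ 2]) (use ne in auto)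
    then have "signed_indicator r C (ori C)
        = unit_flow r y x + unit_flow r x z + unit_flow r z y"
      using signed_indicator_eq_sum[OF r C A] ne by (simp add: add.assoc)
    also have "\<dots> = - ?t"
      using unit_flow_swap[OF r xyz(1,2)] unit_flow_swap[OF r xyz(2,3)]
        unit_flow_swap[OF r xyz(3,1)] by simp
    finally have "?t = - signed_indicator r C (ori C)" by simp
    then show ?thesis
      using gen unfolding cycle_space_def by (simp only: span_neg)
  qed
qed

text \<open>
  Replacing the edge from \<open>x\<close> to \<open>y\<close> by the detour from \<open>x\<close> through
  \<open>p\<close> to \<open>y\<close> changes the flow by the triangle on \<open>x\<close>, \<open>y\<close>,
  \<open>p\<close>. Doing this for all edges turns \<open>f\<close> into a flow along the star, which is determined by
  its divergence.
\<close>

lemma diff_star_flow_in_cycle_space: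
  assumes "finite M" and r: "reference_orientation M r"
    and ori: "\<And>C. is_cycle M C \<Longrightarrow> cycle_orientation C (ori C)"
    and p: "p \<in> M" and f: "f \<in> ell1 M"
  shows "f - star_flow M r p (divergence M r f) \<in> cycle_space M r ori"
proof -
  let ?t = "\<lambda>e. unit_flow r (fst (r e)) (snd (r e))
    + unit_flow r (snd (r e)) p + unit_flow r p (fst (r e))"
  have star: "star_flow M r p (divergence M r f) = (\<Sum>e\<in>complete_edges M. f e *\<^sub>R
      (unit_flow r (fst (r e)) p - unit_flow r (snd (r e)) p))"
    unfolding divergence_def linear_sum[OF linear_star_flow]
    by (intro sum.cong refl)
      (simp add: linear_scale[OF linear_star_flow] linear_diff[OF linear_star_flow]
        star_flow_indicator reference_orientation_edge[OF r] assms(1))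
  have "f - star_flow M r p (divergence M r f) = (\<Sum>e\<in>complete_edges M. f e *\<^sub>R ?t e)"
    unfolding star
    by (subst (1) ell1_expansion[OF assms(1) r f], subst sum_subtractf[symmetric], intro sum.cong refl)
      (simp add: scaleR_diff_right[symmetric] unit_flow_swap[OF r _ p] reference_orientation_edge[OF r])
  also have "\<dots> \<in> cycle_space M r ori"
    unfolding cycle_space_def
    by (intro span_sum span_scale)
      (use triangle_in_cycle_space[OF r ori] p reference_orientation_edge[OF r]
        in \<open>auto simp: cycle_space_def\<close>)
  finally show ?thesis .
qed

lemma cycle_space_eq_kernel:
  assumes "finite M" and r: "reference_orientation M r"
    and ori: "\<And>C. is_cycle M C \<Longrightarrow> cycle_orientation C (ori C)"
  shows "cycle_space M r ori = {f \<in> ell1 M. divergence M r f = 0}" (is "_ = ?K")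
proof
  have "subspace ?K"
    using subspace_inter[OF subspace_ell1 linear_subspace_kernel[OF linear_divergence]]
    by (simp add: Int_def)
  moreover have "signed_indicator r C (ori C) \<in> ?K" if "is_cycle M C" for C
  proof -
    have C: "C \<subseteq> complete_edges M" using is_cycle_subset[OF that] .
    then have "signed_indicator r C (ori C) \<in> ell1 M"
      unfolding ell1_def signed_indicator_def by auto
    then show ?thesis using divergence_signed_indicator[OF assms(1,2) C ori[OF that]] by simp
  qed
  ultimately show "cycle_space M r ori \<subseteq> ?K"
    unfolding cycle_space_def by (intro span_minimal) blast+
  show "?K \<subseteq> cycle_space M r ori"
  proof
    fix f assume f: "f \<in> ?K"
    show "f \<in> cycle_space M r ori"
    proof (cases "M = {}")
      case True
      then have "f = 0" using f by (auto simp: ell1_def complete_edges_def fun_eq_iff)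
      then show ?thesis by (simp add: cycle_space_def span_0)
    next
      case False
      then obtain p where p: "p \<in> M" by auto
      from diff_star_flow_in_cycle_space[OF assms p, of f] f show ?thesis
        by (simp add: linear_0[OF linear_star_flow])
    qed
  qed
qed

section \<open>Transportation cost as a quotient norm\<close>

lemma edge_weight_pair:
  assumes "Metric_space M d" "x \<noteq> y"
  shows "edge_weight d {x, y} = d x y"
  unfolding edge_weight_def
  using assms Metric_space.commute[OF assms(1)]
  by (intro the_equality) (auto simp: doubleton_eq_iff)

lemma edge_weight_nonneg:
  assumes "Metric_space M d" "e \<in> complete_edges M"
  shows "edge_weight d e \<ge> 0"
  using assms edge_weight_pair[OF assms(1)] Metric_space.nonneg[OF assms(1)]
  by (auto simp: complete_edges_def)

lemma ell1_norm_nonneg: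
  assumes "Metric_space M d" shows "ell1_norm M d f \<ge> 0"
  unfolding ell1_norm_def using edge_weight_nonneg[OF assms] by (intro sum_nonneg) auto

lemma ell1_norm_add_le:
  assumes "Metric_space M d"
  shows "ell1_norm M d (f + g) \<le> ell1_norm M d f + ell1_norm M d g"
  unfolding ell1_norm_def sum.distrib[symmetric] distrib_right[symmetric]
  using edge_weight_nonneg[OF assms] by (intro sum_mono mult_right_mono) auto

lemma ell1_norm_scale: "ell1_norm M d (c *\<^sub>R f) = \<bar>c\<bar> * ell1_norm M d f"
  by (simp add: ell1_norm_def scaleR_fun_def abs_mult sum_distrib_left mult.assoc)

lemma ell1_norm_sum_le:
  assumes "Metric_space M d"
  shows "ell1_norm M d (\<Sum>i\<in>I. F i) \<le> (\<Sum>i\<in>I. ell1_norm M d (F i))"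
proof (induction I rule: infinite_finite_induct)
  case (insert i I)
  have "ell1_norm M d (\<Sum>j\<in>insert i I. F j) \<le> ell1_norm M d (F i) + ell1_norm M d (\<Sum>j\<in>I. F j)"
    unfolding sum.insert[OF insert.hyps] by (rule ell1_norm_add_le[OF assms])
  then show ?case
    unfolding sum.insert[OF insert.hyps] using insert.IH by linarith
qed (simp_all add: ell1_norm_def)

lemma ell1_norm_unit_flow:
  assumes "Metric_space M d" "finite M" "x \<in> M" "y \<in> M"
  shows "ell1_norm M d (unit_flow r x y) = d x y"
proof (cases "x = y")
  case True
  then show ?thesis
    using Metric_space.mdist_zero[OF assms(1,3)] by (simp add: ell1_norm_def)
next
  case False
  have "ell1_norm M d (unit_flow r x y)
      = (\<Sum>e\<in>{{x, y}}. \<bar>unit_flow r x y e\<bar> * edge_weight d e)"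
    unfolding ell1_norm_def using assms False finite_complete_edges[of M]
    by (intro sum.mono_neutral_right) (auto simp: complete_edges_pair unit_flow_def)
  also have "\<dots> = d x y"
    using False edge_weight_pair[OF assms(1)] by (simp add: unit_flow_def)
  finally show ?thesis .
qed

text \<open>
  Only an inequality holds here: moves along the same edge in opposite directions cancel in the flow, but both
  count in the cost of the plan.
\<close>

lemma flow_of_plan:
  assumes "Metric_space M d" "finite M" and r: "reference_orientation M r"
    and plan: "transportation_plan M g k a x y"
  obtains f where "f \<in> ell1 M" "divergence M r f = g"
    "ell1_norm M d f \<le> (\<Sum>i<k. a i * d (x i) (y i))"
proof
  let ?f = "\<Sum>i<k. a i *\<^sub>R unit_flow r (x i) (y i)"
  have M: "a i \<ge> 0" "x i \<in> M" "y i \<in> M" if "i < k" for i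
    using plan that by (auto simp: transportation_plan_def)
  show "?f \<in> ell1 M"
    by (intro subspace_sum subspace_scale subspace_ell1 unit_flow_in_ell1) (use M in auto)
  have "divergence M r ?f = (\<Sum>i<k. a i *\<^sub>R (indicator {x i} - indicator {y i}))"
    unfolding linear_sum[OF linear_divergence]
    by (intro sum.cong)
      (use M assms in \<open>simp_all add: linear_scale[OF linear_divergence] divergence_unit_flow\<close>)
  then show "divergence M r ?f = g" using plan by (simp add: transportation_plan_def)
  have "ell1_norm M d ?f \<le> (\<Sum>i<k. ell1_norm M d (a i *\<^sub>R unit_flow r (x i) (y i)))"
    by (rule ell1_norm_sum_le[OF assms(1)])
  also have "\<dots> = (\<Sum>i<k. a i * d (x i) (y i))"
    by (intro sum.cong)
      (use M in \<open>simp_all add: ell1_norm_scale ell1_norm_unit_flow[OF assms(1,2)]\<close>)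
  finally show "ell1_norm M d ?f \<le> (\<Sum>i<k. a i * d (x i) (y i))" .
qed

text \<open>
  Each edge gives one move, directed by the sign of the flow on it, so that the amounts moved are nonnegative
  and the cost is exactly the norm.
\<close>

lemma plan_of_flow:
  assumes "Metric_space M d" "finite M" and r: "reference_orientation M r"
  obtains k a x y where "transportation_plan M (divergence M r f) k a x y"
    "(\<Sum>i<k. a i * d (x i) (y i)) = ell1_norm M d f"
proof -
  let ?E = "complete_edges M"
  \<comment> \<open>a plan is indexed by an initial segment of the naturals, so the edges are enumerated\<close>
  obtain h where h: "bij_betw h {..<card ?E} ?E"
    using ex_bij_betw_nat_finite[OF finite_complete_edges[OF assms(2)]]
    by (auto simp: atLeast0LessThan)
  define X where "X e = (if f e \<ge> 0 then fst (r e) else snd (r e))" for e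
  define Y where "Y e = (if f e \<ge> 0 then snd (r e) else fst (r e))" for e
  have hE: "h i \<in> ?E" if "i < card ?E" for i using h that by (auto simp: bij_betw_def)
  have XY: "X e \<in> M" "Y e \<in> M" "X e \<noteq> Y e" "{X e, Y e} = e" if "e \<in> ?E" for e
    using reference_orientation_edge[OF r that] by (auto simp: X_def Y_def)
  have "(\<Sum>i<card ?E. \<bar>f (h i)\<bar> *\<^sub>R (indicator {X (h i)} - indicator {Y (h i)} :: 'a \<Rightarrow> real))
      = (\<Sum>e\<in>?E. \<bar>f e\<bar> *\<^sub>R (indicator {X e} - indicator {Y e}))"
    by (rule sum.reindex_bij_betw[OF h])
  also have "\<dots> = divergence M r f"
    unfolding divergence_def
    by (intro sum.cong) (auto simp: X_def Y_def scaleR_fun_def fun_eq_iff algebra_simps)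
  finally have "transportation_plan M (divergence M r f) (card ?E)
      (\<lambda>i. \<bar>f (h i)\<bar>) (\<lambda>i. X (h i)) (\<lambda>i. Y (h i))"
    unfolding transportation_plan_def using hE XY(1,2) by auto
  moreover have "(\<Sum>i<card ?E. \<bar>f (h i)\<bar> * d (X (h i)) (Y (h i)))
      = (\<Sum>e\<in>?E. \<bar>f e\<bar> * d (X e) (Y e))"
    by (rule sum.reindex_bij_betw[OF h])
  moreover have "d (X e) (Y e) = edge_weight d e" if "e \<in> ?E" for e
    using edge_weight_pair[OF assms(1) XY(3)[OF that]] XY(4)[OF that] by simp
  ultimately show ?thesis
    by (intro that) (auto simp: ell1_norm_def)
qed

text \<open>
  The norms of the flows in the fibre are among the costs of plans, and below the cost of any plan
  lies the norm of such a flow, so the two sets have the same infimum.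
\<close>

lemma tc_norm_eq_Inf_ell1_norm:
  assumes "Metric_space M d" "finite M" and r: "reference_orientation M r" and g: "g \<in> TP M"
  shows "tc_norm M d g = Inf (ell1_norm M d ` {f \<in> ell1 M. divergence M r f = g})"
proof -
  let ?P = "{(\<Sum>i<k. a i * d (x i) (y i)) | k a x y. transportation_plan M g k a x y}"
  let ?F = "ell1_norm M d ` {f \<in> ell1 M. divergence M r f = g}"
  obtain f where "f \<in> ell1 M" "divergence M r f = g"
    using divergence_image[OF assms(2,3)] g by (metis imageE)
  then have F_ne: "?F \<noteq> {}" by blast
  have sub: "?F \<subseteq> ?P"
  proof
    fix c assume "c \<in> ?F"
    then obtain f where f: "divergence M r f = g" "c = ell1_norm M d f" by blast
    obtain k a x y where "transportation_plan M (divergence M r f) k a x y"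
      "(\<Sum>i<k. a i * d (x i) (y i)) = ell1_norm M d f"
      using plan_of_flow[OF assms(1-3)] .
    then show "c \<in> ?P" unfolding f by (metis (mono_tags, lifting) mem_Collect_eq)
  qed
  have dom: "\<exists>b\<in>?F. b \<le> c" if "c \<in> ?P" for c
  proof -
    from that obtain k a x y where plan: "transportation_plan M g k a x y"
      and c: "c = (\<Sum>i<k. a i * d (x i) (y i))" by blast
    obtain f where "f \<in> ell1 M" "divergence M r f = g"
      "ell1_norm M d f \<le> (\<Sum>i<k. a i * d (x i) (y i))"
      using flow_of_plan[OF assms(1-3) plan] .
    then show ?thesis unfolding c by blast
  qed
  have F_bdd: "bdd_below ?F"
    using ell1_norm_nonneg[OF assms(1)] by (intro bdd_belowI[of _ 0]) blast
  have P_bdd: "bdd_below ?P"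
  proof (rule bdd_belowI)
    fix c assume "c \<in> ?P"
    from dom[OF this] obtain f where "ell1_norm M d f \<le> c" by blast
    then show "0 \<le> c" using ell1_norm_nonneg[OF assms(1), of f] by linarith
  qed
  have "Inf ?P = Inf ?F"
  proof (rule antisym)
    show "Inf ?P \<le> Inf ?F" using F_ne P_bdd sub by (rule cInf_superset_mono)
    have "?P \<noteq> {}" using subset_empty F_ne sub by metis
    then show "Inf ?F \<le> Inf ?P" using F_bdd dom by (rule cInf_mono)
  qed
  then show ?thesis by (simp add: tc_norm_def)
qed

theorem theorem3p1:
  fixes M :: "'a set" and d :: "'a \<Rightarrow> 'a \<Rightarrow> real" and n :: nat
    and r :: "'a set \<Rightarrow> 'a \<times> 'a" and ori :: "'a set set \<Rightarrow> ('a \<times> 'a) set"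
  assumes "Metric_space M d" and "finite M" and "card M = n"
    and "reference_orientation M r"
    and "\<And>C. is_cycle M C \<Longrightarrow> cycle_orientation C (ori C)"
  shows "isometrically_isomorphic (TC M d)
    (quotient_struct (ell1 M) (ell1_norm M d) (cycle_space M r ori))"
  unfolding TC_def
  using linear_divergence subspace_ell1 divergence_image[OF assms(2,4)]
    cycle_space_eq_kernel[OF assms(2,4,5)] tc_norm_eq_Inf_ell1_norm[OF assms(1,2,4)]
  by (rule isometrically_isomorphic_quotient_kernel)

end
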